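(* Let $d>0$ and let $f$ be analytic in the horizontal strip $D_d$ and satisfy, for some $\alpha>1$ and $L>0$, $$|f(z)|\le\frac{L}{1+|z|^\alpha}\qquad\text{for all } z\in D_d.$$ Set $$\beta=\min\left\{\frac{2}{\operatorname{sinc}(\alpha^{-1})},\ \left(\frac{2}{d}\right)^{\alpha-1}B\left(\frac{\alpha}{2}-\frac12,\frac{\alpha}{2}+\frac12\right)\right\},$$ and for every integer $N>0$ choose $$h=\frac{\pi d}{\alpha}\left(\mathbf{W}\left(\frac{\pi d}{\alpha}\left(\frac{2\beta(\alpha-1)}{\pi d}\right)^{\frac1\alpha}(N+1)^{\frac{\alpha-1}{\alpha}}\right)\right)^{-1}.$$ Then the error of sinc interpolation satisfies $$\sup_{x\in\mathbb{R}}\left|f(x)-C_N\{f,h\}(x)\right|\le c\,\mathcal{E}_N,\qquad \mathcal{E}_N=\frac{(N+1)^{1-\alpha}}{\alpha-1}\,h^{-\alpha},$$ where $c=c_1L$ and $c_1$ is a constant dependent only on $\alpha$ and $d$ (in particular independent of $N$).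
   Context: Notation. $\operatorname{sinc}(x)=\frac{\sin \pi x}{\pi x}$ (with $\operatorname{sinc}(0)=1$). For $h>0$, $k\in\mathbb{Z}$: $S\{k,h\}(x)=\operatorname{sinc}\left(\frac{x}{h}-k\right)$. For $h>0$ and an integer $N>0$ the sinc interpolation polynomial of $f$ is $C_N\{f,h\}(x)=\sum_{k=-N}^{N}f(kh)\,S\{k,h\}(x)$. For $d>0$, $D_d=\{z=x+iy:\ x\in(-\infty,\infty),\ |y|\le d\}$. $B(\cdot,\cdot)$ is the Euler beta function. $\mathbf{W}$ denotes the positive branch of the Lambert-W function: for $x\ge 0$, $\mathbf{W}(x)$ is the unique $s\ge0$ with $s e^{s}=x$. *)

theory Defs
  imports "HOL-Complex_Analysis.Complex_Analysis" "HOL-Library.Extended_Real"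
begin

text \<open>Normalised sinc function; not to be confused with the unnormalised
  \<open>sin x / x\<close> of \<open>HOL-Probability\<close>.\<close>

definition nsinc :: "real \<Rightarrow> real" where
  "nsinc x = (if x = 0 then 1 else sin (pi * x) / (pi * x))"

definition sinc_basis :: "int \<Rightarrow> real \<Rightarrow> real \<Rightarrow> real" where
  "sinc_basis k h x = nsinc (x / h - of_int k)"

definition sinc_interp :: "nat \<Rightarrow> (complex \<Rightarrow> complex) \<Rightarrow> real \<Rightarrow> real \<Rightarrow> complex" where
  "sinc_interp N f h x =
     (\<Sum>k = - int N..int N. f (of_real (of_int k * h)) * of_real (sinc_basis k h x))"

definition strip :: "real \<Rightarrow> complex set" where
  "strip d = {z. \<bar>Im z\<bar> \<le> d}"

text \<open>Positive branch of the Lambert W function; meaningful only for \<open>x \<ge> 0\<close>.\<close>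

definition lambert_W :: "real \<Rightarrow> real" where
  "lambert_W x = (THE s. 0 \<le> s \<and> s * exp s = x)"

definition beta_const :: "real \<Rightarrow> real \<Rightarrow> real" where
  "beta_const \<alpha> d =
     min (2 / nsinc (inverse \<alpha>))
         ((2 / d) powr (\<alpha> - 1) * Beta (\<alpha> / 2 - 1 / 2) (\<alpha> / 2 + 1 / 2))"

definition mesh :: "real \<Rightarrow> real \<Rightarrow> nat \<Rightarrow> real" where
  "mesh \<alpha> d N =
     pi * d / \<alpha> *
     inverse (lambert_W
       (pi * d / \<alpha>
        * (2 * beta_const \<alpha> d * (\<alpha> - 1) / (pi * d)) powr (1 / \<alpha>)
        * (real N + 1) powr ((\<alpha> - 1) / \<alpha>)))"

definition err_rate :: "real \<Rightarrow> real \<Rightarrow> nat \<Rightarrow> real" where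
  "err_rate \<alpha> d N = (real N + 1) powr (1 - \<alpha>) / (\<alpha> - 1) * mesh \<alpha> d N powr (- \<alpha>)"

end

(* The contour integral of f(z) / ((z - x) sin(pi z / h)) over the rectangle with real part bounded
   by (M + 1/2) h and imaginary part bounded by d' < d collects the values f(x) and f(k h),
   abs k <= M, as residues at simple poles: up to the factor sin(pi x / h) / (2 pi i) it is the
   interpolation error with M nodes on each side.  On the horizontal sides abs (sin(pi z / h)) is at
   least sinh(pi d' / h) and f is integrable; the vertical sides vanish as M tends to infinity.
   Letting then d' tend to d gives a discretization error of order 1 / sinh(pi d / h), while the
   nodes N < abs k <= M contribute at most the tail of a convergent sum of powers.  The defining
   equation of the Lambert function makes exp(- pi d / h) an exact constant multiple of the error
   rate, so that both parts are of the same order. *)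

theory Submission
  imports Defs
begin

subsection \<open>Lambert function, sinc and beta constant\<close>

lemma strict_mono_on_mult_exp: "strict_mono_on {0..} (\<lambda>s::real. s * exp s)"
  by (rule strict_mono_onI) (auto intro!: mult_strict_mono')

text \<open>Makes the definite description in \<open>lambert_W\<close> meaningful. Existence is the
  intermediate value theorem on the interval from 0 to \<open>x\<close>, since
  \<open>x * exp x\<close> is at least \<open>x\<close>; uniqueness is strict monotonicity.\<close>

lemma ex1_mult_exp:
  fixes x :: real
  assumes "0 \<le> x"
  shows "\<exists>!s. 0 \<le> s \<and> s * exp s = x"
proof (rule ex_ex1I)
  have "x * 1 \<le> x * exp x"
    using assms by (intro mult_left_mono) auto
  then have "\<exists>s\<ge>0. s \<le> x \<and> s * exp s = x"
    using assms by (intro IVT') (auto intro!: continuous_intros)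
  then show "\<exists>s. 0 \<le> s \<and> s * exp s = x"
    by blast
next
  fix s t :: real
  assume "0 \<le> s \<and> s * exp s = x" "0 \<le> t \<and> t * exp t = x"
  then show "s = t"
    using strict_mono_on_eqD[OF strict_mono_on_mult_exp, of s t] by auto
qed

lemma lambert_W_nonneg_and_mult_exp:
  assumes "0 \<le> x"
  shows "0 \<le> lambert_W x \<and> lambert_W x * exp (lambert_W x) = x"
  unfolding lambert_W_def by (rule theI'[OF ex1_mult_exp[OF assms]])

lemma lambert_W_pos:
  assumes "0 < x"
  shows "0 < lambert_W x"
  using lambert_W_nonneg_and_mult_exp[of x] assms by (cases "lambert_W x = 0") auto

lemma lambert_W_mono:
  assumes "0 \<le> x" "x \<le> y"
  shows "lambert_W x \<le> lambert_W y"
proof (rule ccontr)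
  assume "\<not> lambert_W x \<le> lambert_W y"
  then have "lambert_W y * exp (lambert_W y) < lambert_W x * exp (lambert_W x)"
    using strict_mono_onD[OF strict_mono_on_mult_exp, of "lambert_W y" "lambert_W x"]
      lambert_W_nonneg_and_mult_exp[of y] assms by auto
  then show False
    using lambert_W_nonneg_and_mult_exp[of x] lambert_W_nonneg_and_mult_exp[of y] assms by auto
qed

section \<open>Normalised sinc function and positivity of the constant \<beta>\<close>

lemma abs_nsinc_le_1: "\<bar>nsinc x\<bar> \<le> 1"
proof (cases "x = 0")
  case False
  then have "\<bar>nsinc x\<bar> = \<bar>sin (pi * x)\<bar> / \<bar>pi * x\<bar>"
    by (simp add: nsinc_def)
  also have "\<dots> \<le> 1"
    using abs_sin_x_le_abs_x[of "pi * x"] False by (subst divide_le_eq_1_pos) auto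
  finally show ?thesis .
qed (simp add: nsinc_def)

lemma nsinc_of_int: "nsinc (of_int k) = (if k = 0 then 1 else 0)"
  by (simp add: nsinc_def sin_zero_iff_int2)

lemma nsinc_pos:
  assumes "0 < x" "x < 1"
  shows "0 < nsinc x"
proof -
  have "0 < sin (pi * x)"
    using assms by (intro sin_gt_zero) auto
  then show ?thesis
    using assms by (simp add: nsinc_def)
qed

text \<open>The sign \<open>cos (pi * of_int k)\<close>, that is (-1)^k, is its own inverse. It is
  kept in the denominator because the derivative of sin (pi z / h) at a node puts it there in the
  residue.\<close>

lemma nsinc_diff_of_int:
  assumes "sin (pi * x) \<noteq> 0"
  shows "nsinc (x - of_int k) = sin (pi * x) / (pi * (x - of_int k) * cos (pi * of_int k))"
proof -
  have s: "sin (pi * of_int k) = 0"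
    by (simp add: sin_zero_iff_int2)
  have c: "cos (pi * of_int k) * cos (pi * of_int k) = 1"
    using sin_cos_squared_add[of "pi * of_int k"] s by (simp add: power2_eq_square)
  have "x \<noteq> of_int k"
    using assms s by auto
  moreover have "sin (pi * (x - of_int k)) = sin (pi * x) * cos (pi * of_int k)"
    using s by (simp add: right_diff_distrib sin_diff)
  moreover have "cos (pi * of_int k) \<noteq> 0"
    using c by auto
  ultimately show ?thesis
    using c by (simp add: nsinc_def field_simps)
qed

lemma beta_const_pos:
  assumes "0 < d" "1 < \<alpha>"
  shows "0 < beta_const \<alpha> d"
proof -
  have "0 < nsinc (inverse \<alpha>)"
    using assms by (intro nsinc_pos) (auto simp: inverse_less_1_iff)
  moreover have "0 < Beta (\<alpha> / 2 - 1 / 2) (\<alpha> / 2 + 1 / 2)"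
    using assms by (simp add: Beta_def)
  ultimately show ?thesis
    using assms by (simp add: beta_const_def)
qed

subsection \<open>Truncation error\<close>

lemma sum_symmetric_int_Suc:
  fixes g :: "int \<Rightarrow> 'a :: comm_monoid_add"
  shows "(\<Sum>k = - int (Suc M)..int (Suc M). g k) =
    (\<Sum>k = - int M..int M. g k) + (g (int (Suc M)) + g (- int (Suc M)))"
proof -
  have "{- int (Suc M)..int (Suc M)} = insert (int (Suc M)) (insert (- int (Suc M)) {- int M..int M})"
    by auto
  then show ?thesis
    by (simp add: add_ac)
qed

text \<open>The mean value theorem for t^(1 - \<alpha>) between m and m + 1: a discrete integral
  comparison, put as a difference so that sums over m telescope.\<close>

lemma powr_minus_le_telescope:
  fixes \<alpha> m :: real
  assumes "1 < \<alpha>" "0 < m"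
  shows "(m + 1) powr - \<alpha> \<le> (m powr (1 - \<alpha>) - (m + 1) powr (1 - \<alpha>)) / (\<alpha> - 1)"
proof -
  have "\<exists>z>m. z < m + 1 \<and> (m + 1) powr (1 - \<alpha>) - m powr (1 - \<alpha>) =
      (m + 1 - m) * ((1 - \<alpha>) * z powr (1 - \<alpha> - 1))"
    using assms by (intro MVT2) (auto intro!: derivative_eq_intros simp: field_simps)
  then obtain z where z: "m < z" "z < m + 1"
    and eq: "(m + 1) powr (1 - \<alpha>) - m powr (1 - \<alpha>) = (1 - \<alpha>) * z powr - \<alpha>"
    by auto
  have "(m + 1) powr - \<alpha> \<le> z powr - \<alpha>"
    using z assms by (intro powr_mono2') auto
  moreover have "z powr - \<alpha> = (m powr (1 - \<alpha>) - (m + 1) powr (1 - \<alpha>)) / (\<alpha> - 1)"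
    using eq assms by (simp add: field_simps)
  ultimately show ?thesis by simp
qed

text \<open>Consecutive interpolants differ by one pair of nodes, whose basis functions are at most
  1 in modulus, so the decay of f and telescoping bound the whole difference. The bound is free of
  \<open>x\<close> and \<open>M\<close>, which allows M to tend to infinity later.\<close>

lemma norm_sinc_interp_diff_le:
  fixes f :: "complex \<Rightarrow> complex"
  assumes "1 < \<alpha>" "0 < L" "0 < h" "0 < N" "N \<le> M"
    and bound: "\<And>t::real. cmod (f (of_real t)) \<le> L / (1 + \<bar>t\<bar> powr \<alpha>)"
  shows "cmod (sinc_interp M f h x - sinc_interp N f h x)
    \<le> 2 powr \<alpha> * L * h powr - \<alpha> * ((real N + 1) powr (1 - \<alpha>) / (\<alpha> - 1))"
proof -
  \<comment> \<open>The factor 2 accounts for the nodes k and -k, which enter together when M grows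
    by 1.\<close>
  define K where "K = 2 * L * h powr - \<alpha> / (\<alpha> - 1)"
  have K: "0 < K" using assms by (simp add: K_def)
  define g where "g k = f (of_real (of_int k * h)) * of_real (sinc_basis k h x)" for k
  have g: "cmod (g k) \<le> L * h powr - \<alpha> * \<bar>real_of_int k\<bar> powr - \<alpha>" if "k \<noteq> 0" for k
  proof -
    have "cmod (g k) = cmod (f (of_real (of_int k * h))) * \<bar>sinc_basis k h x\<bar>"
      by (simp add: g_def norm_mult)
    also have "\<dots> \<le> cmod (f (of_real (of_int k * h)))"
      by (rule mult_right_le_one_le) (auto simp: sinc_basis_def abs_nsinc_le_1)
    also have "\<dots> \<le> L / (1 + \<bar>of_int k * h\<bar> powr \<alpha>)"
      by (rule bound)
    also have "\<dots> \<le> L / \<bar>of_int k * h\<bar> powr \<alpha>"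
      using that assms by (intro divide_left_mono) (auto intro!: mult_pos_pos add_pos_nonneg)
    also have "\<dots> = L * h powr - \<alpha> * \<bar>real_of_int k\<bar> powr - \<alpha>"
      using that assms by (simp add: abs_mult powr_mult powr_minus field_simps)
    finally show ?thesis .
  qed
  have "cmod (sinc_interp M f h x - sinc_interp N f h x)
      \<le> K * (real N powr (1 - \<alpha>) - real M powr (1 - \<alpha>))"
    using \<open>N \<le> M\<close>
  proof (induction M rule: dec_induct)
    case base
    then show ?case by simp
  next
    case (step M)
    have "M > 0" using step \<open>0 < N\<close> by simp
    have "cmod (sinc_interp (Suc M) f h x - sinc_interp M f h x)
        = cmod (g (int (Suc M)) + g (- int (Suc M)))"
      unfolding sinc_interp_def sum_symmetric_int_Suc g_def by simp
    also have "\<dots> \<le> 2 * (L * h powr - \<alpha> * (real M + 1) powr - \<alpha>)"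
      using norm_triangle_ineq[of "g (int (Suc M))" "g (- int (Suc M))"]
        g[of "int (Suc M)"] g[of "- int (Suc M)"] by (simp add: add_ac abs_minus_commute)
    also have "\<dots> \<le> 2 * (L * h powr - \<alpha> *
        ((real M powr (1 - \<alpha>) - (real M + 1) powr (1 - \<alpha>)) / (\<alpha> - 1)))"
      using assms \<open>M > 0\<close> by (intro mult_left_mono powr_minus_le_telescope) auto
    also have "\<dots> = K * (real M powr (1 - \<alpha>) - (real M + 1) powr (1 - \<alpha>))"
      by (simp add: K_def)
    finally have "cmod (sinc_interp (Suc M) f h x - sinc_interp M f h x) \<le> \<dots>" .
    then show ?case
      using step.IH norm_triangle_ineq[of "sinc_interp (Suc M) f h x - sinc_interp M f h x"
          "sinc_interp M f h x - sinc_interp N f h x"]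
      by (simp add: algebra_simps)
  qed
  also have "\<dots> \<le> K * real N powr (1 - \<alpha>)"
    using K by (intro mult_left_mono) auto
  \<comment> \<open>As N is at least 1, (N + 1) / 2 is at most N, and the exponent is negative. A
    factor 2^(\<alpha> - 1) is the price for replacing N by the N + 1 of
    \<open>err_rate\<close>.\<close>
  also have "\<dots> \<le> K * ((real N + 1) / 2) powr (1 - \<alpha>)"
    using K assms by (intro mult_left_mono powr_mono2') auto
  also have "\<dots> = K * (2 powr (\<alpha> - 1) * (real N + 1) powr (1 - \<alpha>))"
    by (simp add: powr_divide powr_diff)
  also have "\<dots> = 2 powr \<alpha> * L * h powr - \<alpha> * ((real N + 1) powr (1 - \<alpha>) / (\<alpha> - 1))"
    by (simp add: K_def powr_diff mult_ac)
  finally show ?thesis .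
qed

subsection \<open>Estimates on the sides of the rectangle\<close>

text \<open>Exchanges the given decay for a power with an elementary antiderivative; r will be the
  modulus and t the real part of a point. It holds because 1 + |t| <= 2 max(1, r) and max(1,
  r)^\<alpha> <= 1 + r^\<alpha>.\<close>

lemma inverse_one_plus_powr_le:
  fixes \<alpha> r t :: real
  assumes "0 < \<alpha>" "\<bar>t\<bar> \<le> r"
  shows "1 / (1 + r powr \<alpha>) \<le> 2 powr \<alpha> * (1 + \<bar>t\<bar>) powr - \<alpha>"
proof -
  have "(1 + \<bar>t\<bar>) powr \<alpha> \<le> (2 * max 1 r) powr \<alpha>"
    using assms by (intro powr_mono2) auto
  also have "\<dots> = 2 powr \<alpha> * max 1 r powr \<alpha>"
    using assms by (subst powr_mult) auto
  also have "\<dots> \<le> 2 powr \<alpha> * (1 + r powr \<alpha>)"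
    by (intro mult_left_mono) (auto simp: max_def)
  finally show ?thesis
    using assms by (simp add: powr_minus field_simps add_pos_nonneg)
qed

text \<open>The integral of the majorant over the whole real line is 2 C / (\<alpha> - 1), hence a
  bound independent of the length of the side.\<close>

lemma norm_contour_integral_horizontal_le:
  fixes F :: "complex \<Rightarrow> complex"
  assumes "0 < R" "1 < \<alpha>" "0 \<le> C"
    and cont: "continuous_on (closed_segment (Complex (- R) y) (Complex R y)) F"
    and bound: "\<And>t. \<bar>t\<bar> \<le> R \<Longrightarrow> cmod (F (Complex t y)) \<le> C * (1 + \<bar>t\<bar>) powr - \<alpha>"
  shows "cmod (contour_integral (linepath (Complex (- R) y) (Complex R y)) F) \<le> 2 * C / (\<alpha> - 1)"
proof -
  define p where "p = linepath (Complex (- R) y) (Complex R y)"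
  define T where "T s = R * (2 * s - 1)" for s
  define D where "D = C / (\<alpha> - 1)"
  have C_eq: "C = D * (\<alpha> - 1)" and "0 \<le> D"
    using assms by (auto simp: D_def)
  \<comment> \<open>The odd antiderivative of C (1 + |t|)^(-\<alpha>), in one formula for both signs
    of t.\<close>
  define G where "G t = D * sgn t * (1 - (1 + \<bar>t\<bar>) powr (1 - \<alpha>))" for t :: real
  have p: "p s = Complex (T s) y" for s
    by (simp add: p_def T_def linepath_def complex_eq_iff algebra_simps)
  have dp: "vector_derivative p (at s) = of_real (2 * R)" for s
    by (simp add: p_def complex_eq_iff)
  have T: "\<bar>T s\<bar> \<le> R" if "s \<in> {0..1}" for s
    using that \<open>0 < R\<close> by (simp add: T_def abs_mult abs_le_iff)
  have G': "(G has_real_derivative C * (1 + \<bar>t\<bar>) powr - \<alpha>) (at t)" if "t \<noteq> 0" for t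
  proof (cases "t > 0")
    case True
    have "((\<lambda>t. D * (1 - (1 + t) powr (1 - \<alpha>))) has_real_derivative C * (1 + \<bar>t\<bar>) powr - \<alpha>) (at t)"
      using True by (auto intro!: derivative_eq_intros simp: C_eq algebra_simps)
    then show ?thesis
      by (rule has_field_derivative_transform_within_open[of _ _ _ "{0<..}"])
        (use True in \<open>auto simp: G_def\<close>)
  next
    case False
    have "((\<lambda>t. - D * (1 - (1 - t) powr (1 - \<alpha>))) has_real_derivative C * (1 + \<bar>t\<bar>) powr - \<alpha>) (at t)"
      using False that by (auto intro!: derivative_eq_intros simp: C_eq algebra_simps)
    then show ?thesis
      by (rule has_field_derivative_transform_within_open[of _ _ _ "{..<0}"])
        (use False that in \<open>auto simp: G_def\<close>)
  qed
  have G_cont: "continuous_on UNIV G"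
  proof -
    have "isCont G t" for t
    proof (cases "t = 0")
      case True
      have "((\<lambda>t. D * (1 - (1 + \<bar>t\<bar>) powr (1 - \<alpha>))) \<longlongrightarrow> D * (1 - (1 + \<bar>0\<bar>) powr (1 - \<alpha>))) (at 0)"
        using assms by (intro tendsto_intros) auto
      then have "((\<lambda>t. D * (1 - (1 + \<bar>t\<bar>) powr (1 - \<alpha>))) \<longlongrightarrow> 0) (at 0)"
        by simp
      then have "(G \<longlongrightarrow> 0) (at 0)"
        by (rule Lim_null_comparison[rotated, OF tendsto_rabs_zero])
          (auto simp: G_def abs_mult sgn_if)
      then show ?thesis
        using True by (simp add: isCont_def G_def)
    next
      case False
      then show ?thesis
        using G' DERIV_isCont by blast
    qed
    then show ?thesis
      by (simp add: continuous_on_eq_continuous_at)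
  qed
  have int: "((\<lambda>s. 2 * R * (C * (1 + \<bar>T s\<bar>) powr - \<alpha>)) has_integral (G (T 1) - G (T 0))) {0..1}"
  \<comment> \<open>The derivative of \<open>G\<close> is available for nonzero t, so the parameter
    1/2, where \<open>T\<close> vanishes, becomes the exceptional point; continuity suffices
    there.\<close>
  proof (rule fundamental_theorem_of_calculus_interior_strong[of "{1/2}"])
    show "continuous_on {0..1} (\<lambda>s. G (T s))"
      by (rule continuous_on_compose2[OF G_cont]) (auto simp: T_def intro!: continuous_intros)
    fix s :: real assume s: "s \<in> {0<..<1} - {1 / 2}"
    have "(T has_real_derivative 2 * R) (at s)"
      unfolding T_def by (auto intro!: derivative_eq_intros)
    moreover have "T s \<noteq> 0" using s \<open>0 < R\<close> by (auto simp: T_def)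
    ultimately have "((\<lambda>s. G (T s)) has_real_derivative C * (1 + \<bar>T s\<bar>) powr - \<alpha> * (2 * R)) (at s)"
      by (intro DERIV_chain2[OF G'])
    then show "((\<lambda>s. G (T s)) has_vector_derivative 2 * R * (C * (1 + \<bar>T s\<bar>) powr - \<alpha>)) (at s)"
      by (simp add: has_real_derivative_iff_has_vector_derivative mult_ac)
  qed auto
  have "cmod (contour_integral p F) = cmod (integral {0..1} (\<lambda>s. F (p s) * of_real (2 * R)))"
    by (simp only: contour_integral_integral dp)
  also have "\<dots> \<le> integral {0..1} (\<lambda>s. 2 * R * (C * (1 + \<bar>T s\<bar>) powr - \<alpha>))"
  proof (rule integral_norm_bound_integral)
    have "continuous_on {0..1} (\<lambda>s. F (p s))"
      using cont by (rule continuous_on_compose2)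
        (auto simp: p_def intro!: continuous_intros linepath_in_path)
    then show "(\<lambda>s. F (p s) * of_real (2 * R)) integrable_on {0..1}"
      by (intro integrable_continuous_real continuous_intros)
    show "(\<lambda>s. 2 * R * (C * (1 + \<bar>T s\<bar>) powr - \<alpha>)) integrable_on {0..1}"
      using int by blast
    show "cmod (F (p s) * of_real (2 * R)) \<le> 2 * R * (C * (1 + \<bar>T s\<bar>) powr - \<alpha>)"
      if "s \<in> {0..1}" for s
      using bound[OF T[OF that]] \<open>0 < R\<close> by (simp add: norm_mult p)
  qed
  also have "\<dots> = G R - G (- R)"
    using integral_unique[OF int] by (simp add: T_def[of 0] T_def[of 1])
  also have "\<dots> \<le> 2 * C / (\<alpha> - 1)"
  proof -
    have "G R - G (- R) = 2 * D * (1 - (1 + R) powr (1 - \<alpha>))"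
      using \<open>0 < R\<close> by (simp add: G_def)
    also have "\<dots> \<le> 2 * D * 1"
      using \<open>0 \<le> D\<close> by (intro mult_left_mono) auto
    finally show ?thesis by (simp add: D_def)
  qed
  finally show ?thesis
    by (simp add: p_def)
qed

section \<open>Lower bounds for the modulus of the sine on horizontal and vertical sides\<close>

lemma sinh_abs_Im_le_norm_sin: "sinh \<bar>Im z\<bar> \<le> cmod (sin z)"
proof -
  have double: "exp (2 * Im z) = exp (Im z) ^ 2"
    by (rule exp_double)
  have sinh: "sinh (Im z) = (exp (Im z) - inverse (exp (Im z))) / 2"
    by (simp add: sinh_def exp_minus)
  have "sinh (Im z) ^ 2 = (exp (2 * Im z) + inverse (exp (2 * Im z)) - 2) / 4"
    unfolding double sinh by (simp add: power2_eq_square field_simps)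
  then have "sinh \<bar>Im z\<bar> ^ 2 = (exp (2 * Im z) + inverse (exp (2 * Im z)) - 2) / 4"
    by (simp add: abs_if)
  \<comment> \<open>In \<open>norm_sin_squared\<close> the 2 is multiplied by cos (2 Re z), which is
    at most 1.\<close>
  also have "\<dots> \<le> cmod (sin z) ^ 2"
    unfolding norm_sin_squared by (intro divide_right_mono diff_left_mono) auto
  finally show ?thesis
    by (rule power2_le_imp_le) auto
qed

text \<open>When the cosine is -1, the formula for |sin z|^2 becomes cosh^2 (Im z). This is the
  situation on vertical sides halfway between two nodes.\<close>

lemma one_le_norm_sin:
  assumes "cos (2 * Re z) = - 1"
  shows "1 \<le> cmod (sin z)"
proof -
  have "2 \<le> exp (2 * Im z) + inverse (exp (2 * Im z))"
    using cosh_real_ge_1[of "2 * Im z"] by (simp add: cosh_def exp_minus)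
  then have "1\<^sup>2 \<le> cmod (sin z) ^ 2"
    unfolding norm_sin_squared assms by simp
  then show ?thesis
    by (rule power2_le_imp_le) auto
qed

subsection \<open>The interpolation error as a contour integral\<close>

text \<open>Multiplied by w - p, the quotient is f over the difference quotient of g. The value f p
  may be zero, as happens when the interpolated function vanishes at a node.\<close>

lemma residue_divide_simple_zero:
  assumes "open S" "p \<in> S" "(\<lambda>w. f w / g w) holomorphic_on (S - {p})"
    and "isCont f p" "(g has_field_derivative g') (at p)" "g p = 0" "g' \<noteq> 0"
  shows "residue (\<lambda>w. f w / g w) p = f p / g'"
proof (rule residue_simple'[OF assms(1-3)])
  have "((\<lambda>w. (g w - g p) / (w - p)) \<longlongrightarrow> g') (at p)"
    using assms by (simp add: has_field_derivative_iff)
  with assms have "((\<lambda>w. f w / ((g w - g p) / (w - p))) \<longlongrightarrow> f p / g') (at p)"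
    by (intro tendsto_divide) (auto simp: isCont_def)
  then show "((\<lambda>w. f w / g w * (w - p)) \<longlongrightarrow> f p / g') (at p)"
    using \<open>g p = 0\<close> by (simp add: field_simps)
qed

text \<open>For x off the nodes all singularities are at worst simple poles, and the half-integer
  multiple R of h encloses exactly the nodes with |k| <= M. After multiplication by sin (pi x / h)
  the residue at x gives f x and the others give the terms of the interpolant with a minus
  sign.\<close>

lemma contour_integral_rectpath_sinc:
  fixes f :: "complex \<Rightarrow> complex" and M :: nat
  assumes "0 < h" "0 < d'" "d' < d" "\<bar>x\<bar> < R" and sx: "sin (pi * (x / h)) \<noteq> 0"
    and R: "R = (real M + 1 / 2) * h"
    and f: "f holomorphic_on {z. \<bar>Im z\<bar> < d}"
  shows "complex_of_real (sin (pi * (x / h))) *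
      contour_integral (rectpath (Complex (- R) (- d')) (Complex R d'))
        (\<lambda>z. f z / ((z - of_real x) * sin (of_real (pi / h) * z)))
    = 2 * of_real pi * \<i> * (f (of_real x) - sinc_interp M f h x)"
proof -
  define q where "q = complex_of_real (pi / h)"
  \<comment> \<open>The half-width R + h / 2 = (M + 1) h reaches just to the next nodes, which the
    open box omits; the half-height d keeps it inside the domain of f.\<close>
  define S where "S = box (Complex (- (R + h / 2)) (- d)) (Complex (R + h / 2) d)"
  define g where "g z = (z - of_real x) * sin (q * z)" for z
  define node where "node k = complex_of_real (of_int k * h)" for k
  define K where "K = {- int M..int M}"
  define P where "P = insert (of_real x) (node ` K)"
  define \<gamma> where "\<gamma> = rectpath (Complex (- R) (- d')) (Complex R d')"
  have "0 \<le> R" using assms by simp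
  have q: "q \<noteq> 0" using \<open>0 < h\<close> by (simp add: q_def)
  have S: "z \<in> S \<longleftrightarrow> \<bar>Re z\<bar> < (real M + 1) * h \<and> \<bar>Im z\<bar> < d" for z
    using \<open>0 < h\<close> by (auto simp: S_def in_box_complex_iff R algebra_simps abs_less_iff)
  have openS: "open S" and convexS: "convex S"
    by (auto simp: S_def open_box convex_box)
  have q_node: "q * node k = of_real (pi * of_int k)" for k
    using \<open>0 < h\<close> by (simp add: q_def node_def)
  have sin_node: "sin (q * node k) = 0" for k
    unfolding q_node sin_of_real by (simp add: sin_zero_iff_int2)
  have cos_node: "cos (q * node k) = of_real (cos (pi * of_int k))" for k
    unfolding q_node cos_of_real ..
  have sin_x: "sin (q * of_real x) = of_real (sin (pi * (x / h)))"
  proof -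
    have "q * of_real x = of_real (pi * (x / h))"
      by (simp add: q_def)
    then show ?thesis
      by (simp only: sin_of_real)
  qed
  have inj: "inj_on node K"
    using \<open>0 < h\<close> by (auto simp: node_def inj_on_def)
  have node_neq: "node k \<noteq> of_real x" for k
    using sin_node[of k] sin_x sx by (auto simp del: of_real_eq_iff)
  have node_K: "k \<in> K" if "node k \<in> S" for k
  proof -
    have "\<bar>real_of_int k\<bar> * h < (real M + 1) * h"
      using that \<open>0 < h\<close> by (simp add: S node_def abs_mult)
    then have "\<bar>real_of_int k\<bar> < real M + 1"
      using \<open>0 < h\<close> by simp
    then show ?thesis by (auto simp: K_def)
  qed
  have zeros: "z \<in> P" if "z \<in> S" "g z = 0" for z
  proof (cases "z = of_real x")
    case False
    then have "sin (q * z) = 0"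
      using that by (simp add: g_def)
    then obtain n :: int where n: "q * z = of_real (of_int n * pi)"
      unfolding sin_eq_0 by blast
    then have "z = node n"
      using \<open>0 < h\<close> by (simp add: q_def node_def field_simps)
    then show ?thesis using node_K[of n] that by (auto simp: P_def)
  qed (simp add: P_def)
  have P_box: "P \<subseteq> box (Complex (- R) (- d')) (Complex R d')"
  proof -
    have "\<bar>of_int k * h\<bar> < R" if "k \<in> K" for k
    proof -
      have "\<bar>real_of_int k\<bar> < real M + 1 / 2"
        using that by (auto simp: K_def abs_if)
      then show ?thesis
        using \<open>0 < h\<close> by (simp add: R abs_mult)
    qed
    then show ?thesis
      using assms by (fastforce simp: P_def node_def in_box_complex_iff abs_less_iff)
  qed
  have box_S: "cbox (Complex (- R) (- d')) (Complex R d') \<subseteq> S"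
    using assms by (auto simp: S in_cbox_complex_iff algebra_simps)
  have P_S: "P \<subseteq> S"
    using P_box box_S box_subset_cbox by blast
  have fS: "f holomorphic_on S"
    by (rule holomorphic_on_subset[OF f]) (auto simp: S)
  have holo: "(\<lambda>z. f z / g z) holomorphic_on (S - P)"
    using zeros by (intro holomorphic_intros holomorphic_on_subset[OF fS])
      (auto simp: g_def intro!: holomorphic_intros)
  have image: "path_image \<gamma> \<subseteq> cbox (Complex (- R) (- d')) (Complex R d') - box (Complex (- R) (- d')) (Complex R d')"
    unfolding \<gamma>_def using \<open>0 \<le> R\<close> assms by (subst path_image_rectpath_cbox_minus_box) auto
  have res: "residue (\<lambda>z. f z / g z) p = f p / g'"
    if "p \<in> P" "(g has_field_derivative g') (at p)" "g p = 0" "g' \<noteq> 0" for p g'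
  proof (rule residue_divide_simple_zero)
    have "finite P" by (simp add: P_def K_def)
    \<comment> \<open>Deleting the other poles leaves an open set in which p is the only point where
      the quotient may be singular.\<close>
    then show "open (S - (P - {p}))"
      using openS by (intro open_Diff finite_imp_closed) auto
    show "p \<in> S - (P - {p})" using that P_S by auto
    show "(\<lambda>w. f w / g w) holomorphic_on S - (P - {p}) - {p}"
      by (rule holomorphic_on_subset[OF holo]) auto
    show "isCont f p"
      using fS openS that P_S by (meson continuous_on_eq_continuous_at holomorphic_on_imp_continuous_on subsetD)
  qed (use that in auto)
  have res_x: "residue (\<lambda>z. f z / g z) (of_real x) = f (of_real x) / of_real (sin (pi * (x / h)))"
  proof (rule res)
    show "(g has_field_derivative of_real (sin (pi * (x / h)))) (at (of_real x))"
      unfolding g_def sin_x[symmetric] by (auto intro!: derivative_eq_intros)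
    show "complex_of_real (sin (pi * (x / h))) \<noteq> 0"
      using sx by (simp only: of_real_eq_0_iff not_False_eq_True)
  qed (simp_all add: P_def g_def)
  have res_node: "residue (\<lambda>z. f z / g z) (node k) =
      f (node k) / ((node k - of_real x) * (of_real (cos (pi * of_int k)) * q))" if "k \<in> K" for k
  proof (rule res)
    show "(g has_field_derivative (node k - of_real x) * (of_real (cos (pi * of_int k)) * q)) (at (node k))"
      unfolding g_def by (auto intro!: derivative_eq_intros simp: sin_node cos_node)
    have "cos (pi * of_int k) \<noteq> 0"
      using sin_cos_squared_add[of "pi * of_int k"] by (auto simp: sin_zero_iff_int2)
    then show "(node k - of_real x) * (of_real (cos (pi * of_int k)) * q) \<noteq> 0"
      using node_neq q by simp
  qed (use that in \<open>auto simp: P_def g_def sin_node\<close>)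
  have "contour_integral \<gamma> (\<lambda>z. f z / g z) =
      of_real (2 * pi) * \<i> * (\<Sum>p\<in>P. winding_number \<gamma> p * residue (\<lambda>z. f z / g z) p)"
  proof (rule Residue_theorem[OF openS _ _ holo])
    show "connected S" using convexS by (rule convex_connected)
    show "\<forall>z. z \<notin> S \<longrightarrow> winding_number \<gamma> z = 0"
      using image box_S convexS by (auto intro!: winding_number_zero_outside[of _ S] simp: \<gamma>_def)
  qed (use image box_S P_box in \<open>auto simp: \<gamma>_def P_def K_def\<close>)
  also have "(\<Sum>p\<in>P. winding_number \<gamma> p * residue (\<lambda>z. f z / g z) p) = (\<Sum>p\<in>P. residue (\<lambda>z. f z / g z) p)"
    using P_box by (intro sum.cong refl) (auto simp: \<gamma>_def winding_number_rectpath)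
  also have "\<dots> = residue (\<lambda>z. f z / g z) (of_real x) + (\<Sum>k\<in>K. residue (\<lambda>z. f z / g z) (node k))"
  proof -
    have "of_real x \<notin> node ` K" "finite (node ` K)"
      using node_neq by (force simp: K_def)+
    then show ?thesis
      unfolding P_def by (simp add: sum.reindex[OF inj])
  qed
  finally have "of_real (sin (pi * (x / h))) * contour_integral \<gamma> (\<lambda>z. f z / g z) =
      2 * of_real pi * \<i> * (of_real (sin (pi * (x / h))) * residue (\<lambda>z. f z / g z) (of_real x)
        + (\<Sum>k\<in>K. of_real (sin (pi * (x / h))) * residue (\<lambda>z. f z / g z) (node k)))"
    by (simp add: sum_distrib_left algebra_simps)
  also have "of_real (sin (pi * (x / h))) * residue (\<lambda>z. f z / g z) (of_real x) = f (of_real x)"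
    using sx by (simp add: res_x)
  also have "(\<Sum>k\<in>K. of_real (sin (pi * (x / h))) * residue (\<lambda>z. f z / g z) (node k)) = - sinc_interp M f h x"
    unfolding sinc_interp_def K_def[symmetric] sum_negf[symmetric]
  proof (rule sum.cong[OF refl])
    fix k assume "k \<in> K"
    define c where "c = cos (pi * of_int k)"
    \<comment> \<open>The factor h cancels against q = pi / h; the reversed order in
      \<open>node k - of_real x\<close> is the source of the minus sign.\<close>
    have "of_real x - node k = of_real h * of_real (x / h - of_int k)"
      using \<open>0 < h\<close> by (simp add: node_def field_simps)
    then have "node k - of_real x = - (of_real h * of_real (x / h - of_int k))"
      by (metis minus_diff_eq)
    moreover have "sinc_basis k h x = sin (pi * (x / h)) / (pi * (x / h - of_int k) * c)"
      unfolding sinc_basis_def c_def by (rule nsinc_diff_of_int[OF sx])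
    ultimately show "of_real (sin (pi * (x / h))) * residue (\<lambda>z. f z / g z) (node k) =
        - (f (of_real (of_int k * h)) * of_real (sinc_basis k h x))"
      using \<open>0 < h\<close> unfolding res_node[OF \<open>k \<in> K\<close>] c_def[symmetric] q_def
      by (simp add: node_def mult_ac)
  qed
  finally show ?thesis
    by (simp add: \<gamma>_def g_def q_def)
qed

text \<open>The first term comes from the two horizontal sides and is free of x, R and M; the second
  comes from the vertical sides and vanishes as R grows.\<close>

lemma norm_sinc_interp_error_le:
  fixes f :: "complex \<Rightarrow> complex" and M :: nat
  assumes "1 < \<alpha>" "0 < L" "0 < h" "0 < d'" "d' < d" "\<bar>x\<bar> < R" and sx: "sin (pi * (x / h)) \<noteq> 0"
    and R: "R = (real M + 1 / 2) * h"
    and f: "f holomorphic_on {z. \<bar>Im z\<bar> < d}"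
    and bound: "\<And>z. \<bar>Im z\<bar> < d \<Longrightarrow> cmod (f z) \<le> L / (1 + cmod z powr \<alpha>)"
  shows "cmod (f (of_real x) - sinc_interp M f h x)
    \<le> 2 powr (\<alpha> + 1) * L / ((\<alpha> - 1) * pi * d' * sinh (pi * d' / h)) + 2 * d' * L / (pi * (R - \<bar>x\<bar>))"
proof -
  define F where "F z = f z / ((z - of_real x) * sin (of_real (pi / h) * z))" for z
  define a1 a2 a3 a4 where "a1 = Complex (- R) (- d')" and "a2 = Complex R (- d')"
    and "a3 = Complex R d'" and "a4 = Complex (- R) d'"
  \<comment> \<open>Horizontal sides: 2^\<alpha> comes from \<open>inverse_one_plus_powr_le\<close>,
    and the denominator from |z - x| >= d' and |sin (pi z / h)| >= sinh (pi d' / h).\<close>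
  define C where "C = 2 powr \<alpha> * L / (d' * sinh (pi * d' / h))"
  \<comment> \<open>Vertical sides: here |f z| <= L, |z - x| >= R - |x| and |sin (pi z / h)| >=
    1.\<close>
  define B where "B = L / (R - \<bar>x\<bar>)"
  have "0 < R" using \<open>\<bar>x\<bar> < R\<close> by linarith
  have sinh: "0 < sinh (pi * d' / h)" using assms by simp
  have C: "0 \<le> C" and B: "0 \<le> B"
    using assms sinh by (auto simp: C_def B_def)
  have den: "(z - of_real x) * sin (of_real (pi / h) * z) \<noteq> 0" if "\<bar>Im z\<bar> = d'" for z
  proof -
    have "0 < sinh \<bar>Im (of_real (pi / h) * z)\<bar>"
      using assms that by (simp add: abs_mult)
    also have "\<dots> \<le> cmod (sin (of_real (pi / h) * z))"
      by (rule sinh_abs_Im_le_norm_sin)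
    finally show ?thesis
      using that \<open>0 < d'\<close> by auto
  qed
  have horiz: "cmod (F (Complex t y)) \<le> C * (1 + \<bar>t\<bar>) powr - \<alpha>" if "\<bar>y\<bar> = d'" for t y
  proof -
    define z where "z = Complex t y"
    have "cmod (f z) \<le> L * (1 / (1 + cmod z powr \<alpha>))"
      using bound[of z] that assms by (simp add: z_def)
    also have "\<dots> \<le> L * (2 powr \<alpha> * (1 + \<bar>t\<bar>) powr - \<alpha>)"
      using assms abs_Re_le_cmod[of z] by (intro mult_left_mono inverse_one_plus_powr_le) (auto simp: z_def)
    finally have fz: "cmod (f z) \<le> L * (2 powr \<alpha> * (1 + \<bar>t\<bar>) powr - \<alpha>)" .
    have "d' \<le> cmod (z - of_real x)"
      using abs_Im_le_cmod[of "z - of_real x"] that by (simp add: z_def)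
    moreover have "sinh (pi * d' / h) \<le> cmod (sin (of_real (pi / h) * z))"
      using sinh_abs_Im_le_norm_sin[of "of_real (pi / h) * z"] that assms by (simp add: z_def abs_mult)
    ultimately have "d' * sinh (pi * d' / h) \<le> cmod ((z - of_real x) * sin (of_real (pi / h) * z))"
      using assms sinh unfolding norm_mult by (intro mult_mono) auto
    with fz have "cmod (F z) \<le> L * (2 powr \<alpha> * (1 + \<bar>t\<bar>) powr - \<alpha>) / (d' * sinh (pi * d' / h))"
      unfolding F_def norm_divide using assms sinh by (intro frac_le) auto
    then show ?thesis
      by (simp add: C_def z_def mult_ac)
  qed
  have cont_h: "continuous_on {z. \<bar>Im z\<bar> = d'} F"
    unfolding F_def using den assms
    by (intro continuous_intros continuous_on_subset[OF holomorphic_on_imp_continuous_on[OF f]]) auto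
  have seg_h: "closed_segment (Complex s y) (Complex t y) \<subseteq> {z. \<bar>Im z\<bar> = d'}" if "\<bar>y\<bar> = d'" for s t y
    using that by (auto simp: closed_segment_same_Im)
  have I1: "cmod (contour_integral (linepath a1 a2) F) \<le> 2 * C / (\<alpha> - 1)"
    unfolding a1_def a2_def using assms C \<open>0 < R\<close>
    by (intro norm_contour_integral_horizontal_le horiz continuous_on_subset[OF cont_h] seg_h) auto
  \<comment> \<open>The rectangle traverses its top side from right to left, whereas the estimate is
    for segments from left to right; so the reversed segment is estimated.\<close>
  have "cmod (contour_integral (linepath a4 a3) F) \<le> 2 * C / (\<alpha> - 1)"
    unfolding a4_def a3_def using assms C \<open>0 < R\<close>
    by (intro norm_contour_integral_horizontal_le horiz continuous_on_subset[OF cont_h] seg_h) auto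
  moreover have "contour_integral (linepath a4 a3) F = - contour_integral (linepath a3 a4) F"
    unfolding a4_def a3_def using \<open>0 < d'\<close>
    by (intro contour_integral_reverse_linepath continuous_on_subset[OF cont_h] seg_h) auto
  ultimately have I3: "cmod (contour_integral (linepath a3 a4) F) \<le> 2 * C / (\<alpha> - 1)"
    by simp
  define V where "V = {z. \<bar>Re z\<bar> = R \<and> \<bar>Im z\<bar> \<le> d'}"
  have sin_V: "1 \<le> cmod (sin (of_real (pi / h) * z))" if "z \<in> V" for z
  proof (rule one_le_norm_sin)
    \<comment> \<open>The choice R = (M + 1/2) h makes this an odd multiple of pi, with cosine
      -1.\<close>
    have "2 * Re (of_real (pi / h) * z) = pi * (2 * real M + 1) \<or> 2 * Re (of_real (pi / h) * z) = - (pi * (2 * real M + 1))"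
    proof -
      have "Re z = R \<or> Re z = - R"
        using that by (auto simp: V_def abs_if split: if_splits)
      moreover have "2 * Re (of_real (pi / h) * z) = 2 * (pi / h) * Re z"
        by simp
      moreover have "2 * (pi / h) * R = pi * (2 * real M + 1)"
        using \<open>0 < h\<close> by (simp add: R field_simps)
      ultimately show ?thesis
        by (metis mult_minus_right)
    qed
    moreover have "cos (pi * (2 * real M + 1)) = - 1"
      using cos_npi2[of "2 * M + 1"] by (simp add: algebra_simps)
    ultimately show "cos (2 * Re (of_real (pi / h) * z)) = - 1"
      by (metis cos_minus)
  qed
  have den_V: "R - \<bar>x\<bar> \<le> cmod ((z - of_real x) * sin (of_real (pi / h) * z))" if "z \<in> V" for z
  proof -
    have "R - \<bar>x\<bar> \<le> cmod (z - of_real x)"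
      using abs_Re_le_cmod[of "z - of_real x"] that by (auto simp: V_def)
    then have "(R - \<bar>x\<bar>) * 1 \<le> cmod (z - of_real x) * cmod (sin (of_real (pi / h) * z))"
      using sin_V[OF that] assms by (intro mult_mono) auto
    then show ?thesis by (simp add: norm_mult)
  qed
  have vert: "cmod (F z) \<le> B" if "z \<in> V" for z
  proof -
    have "cmod (f z) \<le> L / (1 + cmod z powr \<alpha>)"
      using bound[of z] that assms by (auto simp: V_def)
    also have "\<dots> \<le> L / 1"
      using assms by (intro divide_left_mono) (auto simp: add_pos_nonneg)
    finally show ?thesis
      using den_V[OF that] assms unfolding F_def norm_divide B_def by (intro frac_le) auto
  qed
  have cont_V: "continuous_on V F"
    unfolding F_def using den_V assms
    by (intro continuous_intros continuous_on_subset[OF holomorphic_on_imp_continuous_on[OF f]])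
      (force simp: V_def)+
  have seg_V: "closed_segment a2 a3 \<subseteq> V" "closed_segment a4 a1 \<subseteq> V"
    using assms \<open>0 < R\<close>
    by (auto simp: V_def a1_def a2_def a3_def a4_def closed_segment_same_Re closed_segment_eq_real_ivl)
  have len: "cmod (a3 - a2) = 2 * d'" "cmod (a1 - a4) = 2 * d'"
    using \<open>0 < d'\<close> by (simp_all add: a1_def a2_def a3_def a4_def cmod_eq_Im)
  have I2: "cmod (contour_integral (linepath a2 a3) F) \<le> B * (2 * d')"
    unfolding len(1)[symmetric] using seg_V(1) B vert
    by (intro contour_integral_bound_linepath contour_integrable_continuous_linepath
        continuous_on_subset[OF cont_V]) auto
  have I4: "cmod (contour_integral (linepath a4 a1) F) \<le> B * (2 * d')"
    unfolding len(2)[symmetric] using seg_V(2) B vert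
    by (intro contour_integral_bound_linepath contour_integrable_continuous_linepath
        continuous_on_subset[OF cont_V]) auto
  have integrable: "F contour_integrable_on linepath a1 a2" "F contour_integrable_on linepath a3 a4"
    unfolding a1_def a2_def a3_def a4_def using \<open>0 < d'\<close>
    by (intro contour_integrable_continuous_linepath continuous_on_subset[OF cont_h] seg_h; simp)+
  have integrable': "F contour_integrable_on linepath a2 a3" "F contour_integrable_on linepath a4 a1"
    by (intro contour_integrable_continuous_linepath continuous_on_subset[OF cont_V] seg_V)+
  have "contour_integral (rectpath a1 a3) F = contour_integral (linepath a1 a2) F +
      (contour_integral (linepath a2 a3) F + (contour_integral (linepath a3 a4) F + contour_integral (linepath a4 a1) F))"
    using integrable integrable' by (simp add: rectpath_def Let_def a1_def a2_def a3_def a4_def)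
  also have "cmod \<dots> \<le> 2 * C / (\<alpha> - 1) + (B * (2 * d') + (2 * C / (\<alpha> - 1) + B * (2 * d')))"
    by (intro norm_triangle_le add_mono I1 I2 I3 I4)
  finally have total: "cmod (contour_integral (rectpath a1 a3) F) \<le> 4 * C / (\<alpha> - 1) + 4 * B * d'"
    by simp
  have "2 * pi * cmod (f (of_real x) - sinc_interp M f h x) =
      cmod (2 * of_real pi * \<i> * (f (of_real x) - sinc_interp M f h x))"
    by (simp add: norm_mult)
  also have "2 * of_real pi * \<i> * (f (of_real x) - sinc_interp M f h x) =
      of_real (sin (pi * (x / h))) * contour_integral (rectpath a1 a3) F"
    unfolding a1_def a3_def F_def
    by (rule contour_integral_rectpath_sinc[symmetric]) (use assms in auto)
  also have "cmod \<dots> = \<bar>sin (pi * (x / h))\<bar> * cmod (contour_integral (rectpath a1 a3) F)"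
    by (simp only: norm_mult norm_of_real)
  also have "\<dots> \<le> 1 * (4 * C / (\<alpha> - 1) + 4 * B * d')"
    using total by (intro mult_mono) auto
  finally have "cmod (f (of_real x) - sinc_interp M f h x) \<le> (4 * C / (\<alpha> - 1) + 4 * B * d') / (2 * pi)"
    by (simp add: field_simps)
  also have "\<dots> = 2 * C / ((\<alpha> - 1) * pi) + 2 * d' * B / pi"
    using \<open>1 < \<alpha>\<close> by (simp add: field_simps)
  also have "\<dots> = 2 powr (\<alpha> + 1) * L / ((\<alpha> - 1) * pi * d' * sinh (pi * d' / h)) + 2 * d' * L / (pi * (R - \<bar>x\<bar>))"
    by (simp add: C_def B_def powr_add mult_ac)
  finally show ?thesis .
qed

text \<open>At a node x would be a double zero of the denominator in the contour integral.
  Interpolation is however exact at every node that takes part, so the error is purely one of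
  truncation.\<close>

lemma norm_sinc_interp_error_node_le:
  fixes f :: "complex \<Rightarrow> complex"
  assumes "1 < \<alpha>" "0 < L" "0 < h" "0 < N"
    and sx: "sin (pi * (x / h)) = 0"
    and bound: "\<And>t::real. cmod (f (of_real t)) \<le> L / (1 + \<bar>t\<bar> powr \<alpha>)"
  shows "cmod (f (of_real x) - sinc_interp N f h x)
    \<le> 2 powr \<alpha> * L * h powr - \<alpha> * ((real N + 1) powr (1 - \<alpha>) / (\<alpha> - 1))"
proof -
  obtain j :: int where "pi * (x / h) = of_int j * pi"
    using sx unfolding sin_zero_iff_int2 by blast
  then have x: "x = of_int j * h"
    using \<open>0 < h\<close> by (simp add: field_simps)
  \<comment> \<open>Large enough for node j to take part and for M >= N.\<close>
  define M where "M = max N (nat \<bar>j\<bar>)"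
  have "sinc_basis k h x = (if k = j then 1 else 0)" for k
    using nsinc_of_int[of "j - k"] \<open>0 < h\<close> by (simp add: sinc_basis_def x)
  then have "sinc_interp M f h x = (\<Sum>k = - int M..int M. if k = j then f (of_real x) else 0)"
    unfolding sinc_interp_def by (intro sum.cong) (auto simp: x)
  also have "\<dots> = f (of_real x)"
    by (simp add: M_def max_def) linarith
  finally show ?thesis
    using norm_sinc_interp_diff_le[OF assms(1-4) _ bound, of M x] by (simp add: M_def)
qed

text \<open>Off the nodes the error is split at an interpolant with larger M. For fixed d' < d,
  letting M tend to infinity removes the vertical sides; then d' tends to d from the left, by
  continuity of \<open>?A\<close>. The contours stay at height d' because the hypotheses concern the
  open strip.\<close>

lemma norm_sinc_interp_le:
  fixes f :: "complex \<Rightarrow> complex"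
  assumes "1 < \<alpha>" "0 < L" "0 < h" "0 < d" "0 < N"
    and f: "f holomorphic_on {z. \<bar>Im z\<bar> < d}"
    and bound: "\<And>z. \<bar>Im z\<bar> < d \<Longrightarrow> cmod (f z) \<le> L / (1 + cmod z powr \<alpha>)"
  shows "cmod (f (of_real x) - sinc_interp N f h x)
    \<le> 2 powr (\<alpha> + 1) * L / ((\<alpha> - 1) * pi * d * sinh (pi * d / h))
      + 2 powr \<alpha> * L * h powr - \<alpha> * ((real N + 1) powr (1 - \<alpha>) / (\<alpha> - 1))"
    (is "?err \<le> ?A d + ?T")
proof -
  have real_bound: "cmod (f (of_real t)) \<le> L / (1 + \<bar>t\<bar> powr \<alpha>)" for t
    using bound[of "of_real t"] \<open>0 < d\<close> by simp
  show ?thesis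
  proof (cases "sin (pi * (x / h)) = 0")
    case True
    have "0 \<le> ?A d" using assms by simp
    with norm_sinc_interp_error_node_le[OF assms(1-3,5) True real_bound] show ?thesis
      by linarith
  next
    case False
    have less: "?err \<le> ?A d' + ?T" if "0 < d'" "d' < d" for d'
    proof (rule tendsto_lowerbound)
      have lim: "filterlim (\<lambda>M. (real M + 1 / 2) * h - \<bar>x\<bar>) at_top sequentially"
      proof -
        have "filterlim (\<lambda>M. (h / 2 - \<bar>x\<bar>) + h * real M) at_top sequentially"
          by (intro filterlim_tendsto_add_at_top[OF tendsto_const] filterlim_real_sequentially
              filterlim_tendsto_pos_mult_at_top[OF tendsto_const \<open>0 < h\<close>])
        then show ?thesis by (simp add: algebra_simps)
      qed
      have "((\<lambda>M. ?A d' + 2 * d' * L / pi * inverse ((real M + 1 / 2) * h - \<bar>x\<bar>) + ?T) \<longlongrightarrow> ?A d' + 2 * d' * L / pi * 0 + ?T) sequentially"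
        by (intro tendsto_add tendsto_mult tendsto_const tendsto_inverse_0_at_top[OF lim])
      then show "((\<lambda>M. ?A d' + 2 * d' * L / pi * inverse ((real M + 1 / 2) * h - \<bar>x\<bar>) + ?T) \<longlongrightarrow> ?A d' + ?T) sequentially"
        by simp
      have "\<forall>\<^sub>F M in sequentially. 0 < (real M + 1 / 2) * h - \<bar>x\<bar>"
        using lim by (rule filterlim_at_top_dense[THEN iffD1, THEN spec])
      then show "\<forall>\<^sub>F M in sequentially. ?err \<le> ?A d' + 2 * d' * L / pi * inverse ((real M + 1 / 2) * h - \<bar>x\<bar>) + ?T"
        using eventually_ge_at_top[of N]
      proof eventually_elim
        case (elim M)
        have "cmod (f (of_real x) - sinc_interp M f h x)
            \<le> ?A d' + 2 * d' * L / (pi * ((real M + 1 / 2) * h - \<bar>x\<bar>))"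
          using elim by (intro norm_sinc_interp_error_le[OF assms(1-3) that _ False refl f bound]) auto
        moreover have "cmod (sinc_interp M f h x - sinc_interp N f h x) \<le> ?T"
          using assms elim by (intro norm_sinc_interp_diff_le real_bound) auto
        moreover have "2 * d' * L / (pi * ((real M + 1 / 2) * h - \<bar>x\<bar>)) = 2 * d' * L / pi * inverse ((real M + 1 / 2) * h - \<bar>x\<bar>)"
          by (simp only: divide_inverse inverse_mult_distrib mult.assoc)
        ultimately show ?case
          using norm_triangle_ineq[of "f (of_real x) - sinc_interp M f h x" "sinc_interp M f h x - sinc_interp N f h x"]
          by simp
      qed
    qed simp
    show ?thesis
    proof (rule tendsto_lowerbound)
      show "((\<lambda>d'. ?A d' + ?T) \<longlongrightarrow> ?A d + ?T) (at_left d)"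
        using assms by (intro tendsto_intros) auto
      show "\<forall>\<^sub>F d' in at_left d. ?err \<le> ?A d' + ?T"
        using eventually_at_left_real[OF \<open>0 < d\<close>] by eventually_elim (use less in auto)
    qed simp
  qed
qed

subsection \<open>The choice of the mesh size\<close>

lemma lambert_W_argument_pos:
  assumes "0 < d" "1 < \<alpha>"
  shows "0 < pi * d / \<alpha> * (2 * beta_const \<alpha> d * (\<alpha> - 1) / (pi * d)) powr (1 / \<alpha>)
      * (real N + 1) powr ((\<alpha> - 1) / \<alpha>)"
  using assms beta_const_pos[OF assms] by (intro mult_pos_pos) auto

lemma mesh_pos:
  assumes "0 < d" "1 < \<alpha>"
  shows "0 < mesh \<alpha> d N"
  using assms lambert_W_pos[OF lambert_W_argument_pos[OF assms]] by (simp add: mesh_def)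

text \<open>The argument of \<open>lambert_W\<close> grows with N. Hence N = 1 has the largest mesh
  size among all N >= 1, which bounds pi d / h from below uniformly.\<close>

lemma mesh_antimono:
  assumes "0 < d" "1 < \<alpha>" "M \<le> N"
  shows "mesh \<alpha> d N \<le> mesh \<alpha> d M"
proof -
  define A where "A N = pi * d / \<alpha> * (2 * beta_const \<alpha> d * (\<alpha> - 1) / (pi * d)) powr (1 / \<alpha>)
      * (real N + 1) powr ((\<alpha> - 1) / \<alpha>)" for N
  have A: "0 < A N" for N
    unfolding A_def by (rule lambert_W_argument_pos[OF assms(1,2)])
  have "A M \<le> A N"
    unfolding A_def using assms by (intro mult_left_mono powr_mono2) auto
  then have "lambert_W (A M) \<le> lambert_W (A N)"
    using A[of M] by (intro lambert_W_mono) auto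
  then have "inverse (lambert_W (A N)) \<le> inverse (lambert_W (A M))"
    using lambert_W_pos[OF A] by (intro le_imp_inverse_le)
  then show ?thesis
    unfolding mesh_def A_def[symmetric] using assms by (intro mult_left_mono) auto
qed

text \<open>The reason for the choice of the mesh size. For w = W(A), the equation w exp w = A gives
  exp w = A / w = h b^(1/\<alpha>) n^((\<alpha> - 1)/\<alpha>), while pi d / h = \<alpha> w; raising
  to the power -\<alpha> produces the error rate.\<close>

lemma exp_mesh:
  assumes "0 < d" "1 < \<alpha>"
  shows "exp (- (pi * d / mesh \<alpha> d N)) = pi * d / (2 * beta_const \<alpha> d) * err_rate \<alpha> d N"
proof -
  define b where "b = 2 * beta_const \<alpha> d * (\<alpha> - 1) / (pi * d)"
  define n where "n = real N + 1"
  define h where "h = mesh \<alpha> d N"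
  define A where "A = pi * d / \<alpha> * b powr (1 / \<alpha>) * n powr ((\<alpha> - 1) / \<alpha>)"
  have b: "0 < b" using assms beta_const_pos[OF assms] by (simp add: b_def)
  have n: "0 < n" by (simp add: n_def)
  have h: "0 < h" using mesh_pos[OF assms] by (simp add: h_def)
  have A: "0 < A"
    unfolding A_def b_def n_def by (rule lambert_W_argument_pos[OF assms])
  have h_eq: "h = pi * d / \<alpha> * inverse (lambert_W A)"
    by (simp add: h_def mesh_def A_def b_def n_def)
  have W: "0 < lambert_W A" "lambert_W A * exp (lambert_W A) = A"
    using lambert_W_pos[OF A] lambert_W_nonneg_and_mult_exp[of A] A by auto
  have "exp (lambert_W A) = A / lambert_W A"
    using W by (simp add: field_simps)
  also have "\<dots> = h * b powr (1 / \<alpha>) * n powr ((\<alpha> - 1) / \<alpha>)"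
    using assms W by (simp add: h_eq A_def field_simps)
  finally have exp_W: "exp (lambert_W A) = h * b powr (1 / \<alpha>) * n powr ((\<alpha> - 1) / \<alpha>)" .
  have "pi * d / h = \<alpha> * lambert_W A"
    using assms W by (simp add: h_eq field_simps)
  then have "exp (- (pi * d / h)) = exp (lambert_W A) powr - \<alpha>"
    by (simp add: powr_def)
  also have "\<dots> = h powr - \<alpha> * b powr - 1 * n powr (1 - \<alpha>)"
    using assms b n h unfolding exp_W by (simp add: powr_mult powr_powr)
  also have "\<dots> = pi * d / (2 * beta_const \<alpha> d) * (n powr (1 - \<alpha>) / (\<alpha> - 1) * h powr - \<alpha>)"
    using assms beta_const_pos[OF assms] by (simp add: powr_minus b_def)
  finally show ?thesis
    by (simp add: err_rate_def h_def n_def)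
qed

text \<open>Since sinh u = (1 - exp (-2u)) exp u / 2, the factor in front of exp (-u) is decreasing
  in u; its value at v serves for all u >= v.\<close>

lemma inverse_sinh_le:
  fixes u v :: real
  assumes "0 < v" "v \<le> u"
  shows "1 / sinh u \<le> 2 / (1 - exp (- 2 * v)) * exp (- u)"
proof -
  have sinh: "sinh u = (1 - exp (- 2 * u)) * exp u / 2"
    by (simp add: sinh_def left_diff_distrib flip: exp_add)
  have "1 / sinh u = 2 / (1 - exp (- 2 * u)) * exp (- u)"
    unfolding sinh exp_minus[of u] by (simp only: divide_inverse inverse_mult_distrib) simp
  also have "\<dots> \<le> 2 / (1 - exp (- 2 * v)) * exp (- u)"
    using assms by (intro mult_right_mono divide_left_mono) auto
  finally show ?thesis .
qed

section \<open>Assembly of both error parts with a constant depending on \<alpha> and d\<close>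

theorem theorem2p1:
  fixes d \<alpha> :: real
  assumes "d > 0" and "\<alpha> > 1"
  shows "\<exists>c\<^sub>1::real. \<forall>(f :: complex \<Rightarrow> complex) (L::real).
           L > 0 \<longrightarrow> f analytic_on strip d \<longrightarrow>
           (\<forall>z\<in>strip d. cmod (f z) \<le> L / (1 + cmod z powr \<alpha>)) \<longrightarrow>
           (\<forall>N::nat. N > 0 \<longrightarrow>
             (SUP x::real. ereal (cmod (f (of_real x) - sinc_interp N f (mesh \<alpha> d N) x)))
               \<le> ereal (c\<^sub>1 * L * err_rate \<alpha> d N))"
proof -
  \<comment> \<open>The least value of pi d / h over all N >= 1, by
    \<open>mesh_antimono\<close>.\<close>
  define v where "v = pi * d / mesh \<alpha> d 1"
  \<comment> \<open>Converts 1 / sinh (pi d / h) into a multiple of the error rate: the first factor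
    is from \<open>inverse_sinh_le\<close>, the second from \<open>exp_mesh\<close>.\<close>
  define s where "s = 2 / (1 - exp (- 2 * v)) * (pi * d / (2 * beta_const \<alpha> d))"
  \<comment> \<open>Discretization error plus truncation error, both per unit of L and of the error
    rate.\<close>
  define c where "c = 2 powr (\<alpha> + 1) / ((\<alpha> - 1) * pi * d) * s + 2 powr \<alpha>"
  have "cmod (f (of_real x) - sinc_interp N f (mesh \<alpha> d N) x) \<le> c * L * err_rate \<alpha> d N"
    if "0 < L" and f: "f analytic_on strip d"
      and bound: "\<forall>z\<in>strip d. cmod (f z) \<le> L / (1 + cmod z powr \<alpha>)" and "0 < N"
    for f :: "complex \<Rightarrow> complex" and L x and N :: nat
  proof -
    define h where "h = mesh \<alpha> d N"
    have h: "0 < h" using mesh_pos[OF assms] by (simp add: h_def)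
    have "0 < v" using mesh_pos[OF assms] assms by (simp add: v_def)
    moreover have "v \<le> pi * d / h"
      unfolding v_def h_def using assms \<open>0 < N\<close>
      by (intro divide_left_mono mesh_antimono mult_pos_pos mesh_pos) auto
    ultimately have "1 / sinh (pi * d / h) \<le> 2 / (1 - exp (- 2 * v)) * exp (- (pi * d / h))"
      by (rule inverse_sinh_le)
    then have sinh: "1 / sinh (pi * d / h) \<le> s * err_rate \<alpha> d N"
      unfolding h_def exp_mesh[OF assms] by (simp only: s_def mult.assoc)
    have "f holomorphic_on {z. \<bar>Im z\<bar> < d}"
      using analytic_imp_holomorphic[OF f] by (rule holomorphic_on_subset) (auto simp: strip_def)
    then have "cmod (f (of_real x) - sinc_interp N f h x)
        \<le> 2 powr (\<alpha> + 1) * L / ((\<alpha> - 1) * pi * d * sinh (pi * d / h))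
          + 2 powr \<alpha> * L * h powr - \<alpha> * ((real N + 1) powr (1 - \<alpha>) / (\<alpha> - 1))"
      using that assms h bound by (intro norm_sinc_interp_le) (auto simp: strip_def)
    also have "\<dots> = 2 powr (\<alpha> + 1) * L / ((\<alpha> - 1) * pi * d) * (1 / sinh (pi * d / h))
        + 2 powr \<alpha> * L * err_rate \<alpha> d N"
      by (simp add: err_rate_def h_def)
    also have "\<dots> \<le> 2 powr (\<alpha> + 1) * L / ((\<alpha> - 1) * pi * d) * (s * err_rate \<alpha> d N)
        + 2 powr \<alpha> * L * err_rate \<alpha> d N"
      using assms \<open>0 < L\<close> by (intro add_right_mono mult_left_mono sinh) auto
    also have "\<dots> = c * L * err_rate \<alpha> d N"
      by (simp add: c_def algebra_simps)
    finally show ?thesis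
      by (simp add: h_def)
  qed
  then show ?thesis
    by (intro exI[of _ c]) (auto intro!: SUP_least)
qed

end
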